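(* Let $\chi\in\psi$ be a kernel such that $m_{(1,0)}(\chi,u,v)=m_{(0,1)}(\chi,u,v)=0$ for all $(u,v)\in\mathbb{R}^2_+$. Let $(x,y)\in\mathbb{R}^2_+$ and let $f:\mathbb{R}^2_+\to\mathbb{R}$ be a bounded, locally integrable function that belongs to $C^{(2)}$ locally at $(x,y)$ (i.e. $f$ has continuous partial derivatives up to order $2$ in a neighbourhood of $(x,y)$). Then $$\lim_{w\to\infty}w\big[(I_w^{\chi}f)(x,y)-f(x,y)\big]=\frac12\big[\theta_xf(x,y)+\theta_yf(x,y)\big].$$
   Context: $\mathbb{R}_+=(0,\infty)$, $\mathbb{R}^2_+=\mathbb{R}_+\times\mathbb{R}_+$. $C(\mathbb{R}^2_+)$ is the space of continuous bounded functions on $\mathbb{R}^2_+$. Mellin partial derivatives: $\theta_xf=x\,\frac{\partial f}{\partial x}$ and $\theta_yf=y\,\frac{\partial f}{\partial y}$. Moments. For $\chi\in C(\mathbb{R}^2_+)$ and $p_1,p_2\in\mathbb{N}_0$, the algebraic moments are $$m_{(p_1,p_2)}(\chi,u,v)=\sum_{k\in\mathbb{Z}}\sum_{j\in\mathbb{Z}}\chi(e^{-k}u,e^{-j}v)(k-\log u)^{p_1}(j-\log v)^{p_2},\qquad (u,v)\in\mathbb{R}^2_+,$$ and the absolute moments are $$M_{(p_1,p_2)}(\chi)=\sup_{(u,v)\in\mathbb{R}^2_+}\sum_{k\in\mathbb{Z}}\sum_{j\in\mathbb{Z}}|\chi(e^{-k}u,e^{-j}v)|\,|k-\log u|^{p_1}|j-\log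 v|^{p_2},$$ with $M_\eta(\chi)=\max_{p_1+p_2=\eta}M_{(p_1,p_2)}(\chi)$ for $\eta\in\mathbb{N}_0$. Kernel class. $\psi$ is the class of real-valued $\chi\in C(\mathbb{R}^2_+)$ such that: (K1) $\sum_{k\in\mathbb{Z}}\sum_{j\in\mathbb{Z}}\chi(e^{-k}u,e^{-j}v)=1$ for every $(u,v)\in\mathbb{R}^2_+$; (K2) $M_2(\chi)<+\infty$ and, for all $p_1,p_2\in\mathbb{N}_0$ with $p_1+p_2=2$, $$\lim_{\gamma\to+\infty}\ \sum\sum_{(k,j)\notin B_\gamma(\log u,\log v)}|\chi(e^{-k}u,e^{-j}v)|\,|k-\log u|^{p_1}|j-\log v|^{p_2}=0$$ uniformly in $(u,v)\in\mathbb{R}^2_+$, where $(k,j)$ ranges over $\mathbb{Z}^2$ and $B_\gamma(a,b)$ is the open Euclidean disc of radius $\gamma$ centred at $(a,b)\in\mathbb{R}^2$. Operator. For $\chi\in\psi$ and $w>0$, the bivariate Kantorovich exponential sampling series of a locally integrable $f:\mathbb{R}^2_+\to\mathbb{R}$ is $$(I_w^{\chi}f)(x,y)=\sum_{k\in\mathbb{Z}}\sum_{j\in\mathbb{Z}}\chi(e^{-k}x^w,e^{-j}y^w)\,w^2\int_{k/w}^{(k+1)/w}\left(\int_{j/w}^{(j+1)/w}f(e^u,e^v)\,dv\right)du,\qquad (x,y)\in\mathbb{R}^2_+,$$ whenever this series converges for every $(x,y)\in\mathbb{R}^2_+$. *)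

theory Defs
  imports "HOL-Analysis.Analysis"
begin

text \<open>
  Functions on the open positive quadrant are total functions on \<^typ>\<open>real \<times> real\<close>; only their values
  on \<open>R2pos\<close> are ever used. The distance on \<^typ>\<open>real \<times> real\<close> is the Euclidean one.
\<close>

definition R2pos :: "(real \<times> real) set" where
  "R2pos = {0<..} \<times> {0<..}"

definition partial_x :: "(real \<times> real \<Rightarrow> real) \<Rightarrow> real \<times> real \<Rightarrow> real" where
  "partial_x f = (\<lambda>(x, y). deriv (\<lambda>s. f (s, y)) x)"

definition partial_y :: "(real \<times> real \<Rightarrow> real) \<Rightarrow> real \<times> real \<Rightarrow> real" where
  "partial_y f = (\<lambda>(x, y). deriv (\<lambda>t. f (x, t)) y)"

definition mellin_x :: "(real \<times> real \<Rightarrow> real) \<Rightarrow> real \<times> real \<Rightarrow> real" where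
  "mellin_x f = (\<lambda>(x, y). x * partial_x f (x, y))"

definition mellin_y :: "(real \<times> real \<Rightarrow> real) \<Rightarrow> real \<times> real \<Rightarrow> real" where
  "mellin_y f = (\<lambda>(x, y). y * partial_y f (x, y))"

text \<open>Existence of the partial derivatives is required separately, as \<^const>\<open>deriv\<close> is total.\<close>

fun Cn_on :: "nat \<Rightarrow> (real \<times> real) set \<Rightarrow> (real \<times> real \<Rightarrow> real) \<Rightarrow> bool" where
  "Cn_on 0 U f \<longleftrightarrow> continuous_on U f"
| "Cn_on (Suc n) U f \<longleftrightarrow>
     continuous_on U f \<and>
     (\<forall>(x, y) \<in> U. (\<lambda>s. f (s, y)) field_differentiable (at x) \<and>
                   (\<lambda>t. f (x, t)) field_differentiable (at y)) \<and>
     Cn_on n U (partial_x f) \<and> Cn_on n U (partial_y f)"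

definition locally_Cn_at :: "nat \<Rightarrow> real \<times> real \<Rightarrow> (real \<times> real \<Rightarrow> real) \<Rightarrow> bool" where
  "locally_Cn_at n p f \<longleftrightarrow> (\<exists>U. open U \<and> p \<in> U \<and> U \<subseteq> R2pos \<and> Cn_on n U f)"

definition locally_integrable :: "(real \<times> real \<Rightarrow> real) \<Rightarrow> bool" where
  "locally_integrable f \<longleftrightarrow>
     (\<forall>K. compact K \<longrightarrow> K \<subseteq> R2pos \<longrightarrow> f absolutely_integrable_on K)"

text \<open>
  Double series are unordered sums over pairs of integers. For the kernels considered below, the
  moments of order at most 2 and (for bounded \<open>f\<close>) the sampling series converge absolutely, so
  that these sums agree with the iterated ones and are never the default value 0 that
  \<^const>\<open>infsum\<close> assigns to divergent series.
\<close>

definition moment ::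
    "nat \<Rightarrow> nat \<Rightarrow> (real \<times> real \<Rightarrow> real) \<Rightarrow> real \<Rightarrow> real \<Rightarrow> real" where
  "moment p q \<kappa> u v =
     (\<Sum>\<^sub>\<infinity>(k, j) \<in> (UNIV :: (int \<times> int) set).
        \<kappa> (exp (- of_int k) * u, exp (- of_int j) * v)
          * (of_int k - ln u) ^ p * (of_int j - ln v) ^ q)"

definition abs_moment_term ::
    "nat \<Rightarrow> nat \<Rightarrow> (real \<times> real \<Rightarrow> real) \<Rightarrow> real \<Rightarrow> real \<Rightarrow> int \<times> int \<Rightarrow> real" where
  "abs_moment_term p q \<kappa> u v = (\<lambda>(k, j).
     \<bar>\<kappa> (exp (- of_int k) * u, exp (- of_int j) * v)\<bar>
       * \<bar>of_int k - ln u\<bar> ^ p * \<bar>of_int j - ln v\<bar> ^ q)"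

definition abs_moment :: "nat \<Rightarrow> nat \<Rightarrow> (real \<times> real \<Rightarrow> real) \<Rightarrow> ennreal" where
  "abs_moment p q \<kappa> =
     (SUP (u, v) \<in> R2pos. \<Sum>\<^sub>\<infinity>kj \<in> UNIV. ennreal (abs_moment_term p q \<kappa> u v kj))"

definition abs_moment_order :: "nat \<Rightarrow> (real \<times> real \<Rightarrow> real) \<Rightarrow> ennreal" where
  "abs_moment_order \<eta> \<kappa> = Max {abs_moment p q \<kappa> | p q. p + q = \<eta>}"

definition outside_disc :: "real \<Rightarrow> real \<Rightarrow> real \<Rightarrow> (int \<times> int) set" where
  "outside_disc \<gamma> a b = {(k, j). (of_int k, of_int j) \<notin> ball (a, b) \<gamma>}"

text \<open>The tail sums in the last condition are real-valued: they converge because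
  \<open>abs_moment_order 2 \<kappa>\<close> is finite.\<close>

definition kernel_class :: "(real \<times> real \<Rightarrow> real) set" where
  "kernel_class = {\<kappa>.
     continuous_on R2pos \<kappa> \<and> bounded (\<kappa> ` R2pos) \<and>
     (\<forall>(u, v) \<in> R2pos.
        ((\<lambda>(k, j). \<kappa> (exp (- of_int k) * u, exp (- of_int j) * v)) has_sum 1)
          (UNIV :: (int \<times> int) set)) \<and>
     abs_moment_order 2 \<kappa> < \<infinity> \<and>
     (\<forall>p q. p + q = 2 \<longrightarrow>
        uniform_limit R2pos
          (\<lambda>\<gamma> (u, v). \<Sum>\<^sub>\<infinity>kj \<in> outside_disc \<gamma> (ln u) (ln v). abs_moment_term p q \<kappa> u v kj)
          (\<lambda>_. 0) at_top)}"

definition kantorovich_series ::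
    "(real \<times> real \<Rightarrow> real) \<Rightarrow> real \<Rightarrow> (real \<times> real \<Rightarrow> real) \<Rightarrow> real \<times> real \<Rightarrow> real" where
  "kantorovich_series \<kappa> w f = (\<lambda>(x, y).
     \<Sum>\<^sub>\<infinity>(k, j) \<in> (UNIV :: (int \<times> int) set).
        \<kappa> (exp (- of_int k) * x powr w, exp (- of_int j) * y powr w) * w\<^sup>2 *
        (LINT u:{of_int k / w..(of_int k + 1) / w}|lebesgue.
          (LINT v:{of_int j / w..(of_int j + 1) / w}|lebesgue. f (exp u, exp v))))"

end

theory Submission
  imports Defs
begin

text \<open>
  Put \<open>a = ln x\<close>, \<open>b = ln y\<close> and \<open>g (u, v) = f (exp u, exp v)\<close>. The partial derivatives of \<open>g\<close> at \<open>(a, b)\<close>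
  are the Mellin derivatives \<open>p\<close> and \<open>r\<close> of \<open>f\<close> at \<open>(x, y)\<close>, and the sampling series averages \<open>g\<close> over the cells
  \<open>[k/w, (k+1)/w] \<times> [j/w, (j+1)/w]\<close> with the kernel weights \<open>\<kappa> (exp (-k) * x powr w, exp (-j) * y powr w)\<close>.

  Expand \<open>g\<close> at \<open>(a, b)\<close>. As \<open>g\<close> is twice continuously differentiable near \<open>(a, b)\<close> and bounded, it differs
  from \<open>g (a, b) + p * (u - a) + r * (v - b)\<close> by at most \<open>D * ((u - a)\<^sup>2 + (v - b)\<^sup>2)\<close> on the whole plane
  (\<open>log_coordinates_quadratic_remainder\<close>). The mean of the affine part over the cell \<open>(k, j)\<close> is
  \<open>f (x, y) + (p * (k - w*a + 1/2) + r * (j - w*b + 1/2)) / w\<close>. Summed against the kernel it gives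
  exactly \<open>f (x, y) + (p + r) / (2 * w)\<close>: the weights add up to 1, and the first moments, taken at a
  point with logarithms \<open>w*a\<close> and \<open>w*b\<close>, vanish. The mean of the remainder is at most
  \<open>4 * D * (1 + (k - w*a)\<^sup>2 + (j - w*b)\<^sup>2) / w\<^sup>2\<close> (\<open>cell_mean_quadratic_remainder\<close>), and the kernel sums
  of this weight are bounded uniformly (\<open>kernel_weighted_absolute_sum\<close>), so the remainder contributes
  \<open>O(1 / w\<^sup>2)\<close> to the series. Multiplication by \<open>w\<close> leaves \<open>(p + r) / 2 + O(1 / w)\<close>.

  The integrals over the cells are iterated, while \<open>f\<close> is only known to be Lebesgue measurable as
  a function of two variables; the passage between the two goes through a Borel representative of \<open>g\<close>
  (\<open>exp_pullback_Borel_representative\<close>).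
\<close>

section \<open>Means of nearly affine functions over intervals and rectangles\<close>

text \<open>
  The mean of an affine function over an interval is its value at the midpoint, and taking means
  does not increase a uniform error. The error bound is asked for almost everywhere because the
  lemma is applied twice: to the sections of a function of two variables, and then to the inner
  integral as a function of the outer variable, which is controlled only where the section is
  measurable.
\<close>

lemma interval_mean_affine_approx:
  fixes h :: "real \<Rightarrow> real"
  assumes "s < t" and meas: "set_borel_measurable lebesgue {s..t} h"
    and approx: "AE x in lebesgue. x \<in> {s..t} \<longrightarrow> \<bar>h x - (c + r * x)\<bar> \<le> q"
  shows "\<bar>(LINT x:{s..t}|lebesgue. h x) / (t - s) - (c + r * ((s + t) / 2))\<bar> \<le> q"
proof -
  let ?J = "{s..t}" and ?L = "\<lambda>x. c + r * x"
  have cont: "set_integrable lebesgue ?J g" if "continuous_on ?J g" for g :: "real \<Rightarrow> real"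
    using absolutely_integrable_continuous_real[OF that] .
  have L: "set_integrable lebesgue ?J ?L" by (intro cont continuous_intros)
  have h: "set_integrable lebesgue ?J h"
  proof (rule set_integrable_bound[OF _ meas])
    show "set_integrable lebesgue ?J (\<lambda>x. \<bar>?L x\<bar> + \<bar>q\<bar>)" by (intro cont continuous_intros)
    show "AE x in lebesgue. x \<in> ?J \<longrightarrow> norm (h x) \<le> norm (\<bar>?L x\<bar> + \<bar>q\<bar>)"
      using approx by eventually_elim auto
  qed
  have d: "set_integrable lebesgue ?J (\<lambda>x. h x - ?L x)" using h L by (rule set_integral_diff)
  have intL: "(LINT x:?J|lebesgue. ?L x) = (c + r * ((s + t) / 2)) * (t - s)"
  proof -
    have "((\<lambda>x. c + r * x) has_integral (c * (t - s) + r * ((t\<^sup>2 - s\<^sup>2) / 2))) ?J"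
      using \<open>s < t\<close> has_integral_add[OF has_integral_const_real[of c s t]
          has_integral_mult_right[OF ident_has_integral[of s t], of r]]
      by (simp add: mult.commute)
    then show ?thesis
      using set_lebesgue_integral_eq_integral(2)[OF L]
      by (simp add: integral_unique power2_eq_square algebra_simps)
  qed
  have const: "(LINT x:?J|lebesgue. q) = q * (t - s)"
    using \<open>s < t\<close> by (simp add: set_lebesgue_integral_eq_integral(2)[OF cont] mult.commute)
  have "\<bar>LINT x:?J|lebesgue. h x - ?L x\<bar> \<le> (LINT x:?J|lebesgue. \<bar>h x - ?L x\<bar>)"
    using set_integral_norm_bound[OF d] by simp
  also have "\<dots> \<le> (LINT x:?J|lebesgue. q)"
    using approx set_integrable_abs[OF d] cont[of "\<lambda>_. q"]
    by (intro set_integral_mono_AE) auto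
  finally have "\<bar>(LINT x:?J|lebesgue. h x) - (c + r * ((s + t) / 2)) * (t - s)\<bar> \<le> q * (t - s)"
    using set_integral_diff(2)[OF h L] intL const by simp
  then have "\<bar>((LINT x:?J|lebesgue. h x) - (c + r * ((s + t) / 2)) * (t - s)) / (t - s)\<bar> \<le> q"
    using \<open>s < t\<close> by (simp add: field_simps)
  then show ?thesis using \<open>s < t\<close> by (simp add: diff_divide_distrib)
qed

lemma interval_Borel_representative:
  fixes h h0 :: "real \<Rightarrow> real"
  assumes "h0 \<in> borel_measurable borel" and "AE x in lborel. x \<in> {s..t} \<longrightarrow> h x = h0 x"
  shows "set_borel_measurable lebesgue {s..t} h"
    and "(LINT x:{s..t}|lebesgue. h x) = (LINT x:{s..t}|lborel. h0 x)"
proof -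
  have m: "(\<lambda>x. indicator {s..t} x *\<^sub>R h0 x) \<in> borel_measurable lborel"
    using assms(1) by measurable
  have ae: "AE x in lebesgue. indicator {s..t} x *\<^sub>R h x = indicator {s..t} x *\<^sub>R h0 x"
    by (rule AE_completion) (use assms(2) in \<open>eventually_elim; auto simp: indicator_def\<close>)
  show meas: "set_borel_measurable lebesgue {s..t} h"
    unfolding set_borel_measurable_def
    by (rule borel_measurable_AE[OF measurable_completion[OF m]]) (use ae in \<open>eventually_elim; auto\<close>)
  show "(LINT x:{s..t}|lebesgue. h x) = (LINT x:{s..t}|lborel. h0 x)"
    using integral_cong_AE[OF meas[unfolded set_borel_measurable_def] measurable_completion[OF m] ae]
      integral_completion[OF m]
    by (simp add: set_lebesgue_integral_def)
qed

text \<open>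
  A Lebesgue measurable function on the plane may have non-measurable sections, whose inner integral
  is the default value 0. A Borel representative \<open>G\<close> repairs this: by Fubini for null sets, almost
  every section of \<open>g\<close> agrees almost everywhere with the Borel section of \<open>G\<close>, so the inner integral
  coincides almost everywhere with a Borel function of the outer variable, and the one-dimensional
  estimate can be iterated.
\<close>

lemma rectangle_mean_affine_approx:
  fixes g G :: "real \<times> real \<Rightarrow> real"
  assumes "s < t" "s' < t'" and [measurable]: "G \<in> borel_measurable borel"
    and ae: "AE z in lborel. z \<in> {s..t} \<times> {s'..t'} \<longrightarrow> g z = G z"
    and approx: "\<And>u v. u \<in> {s..t} \<Longrightarrow> v \<in> {s'..t'} \<Longrightarrow> \<bar>g (u, v) - (c + p * u + r * v)\<bar> \<le> q"
  shows "\<bar>(LINT u:{s..t}|lebesgue. LINT v:{s'..t'}|lebesgue. g (u, v)) / ((t - s) * (t' - s'))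
          - (c + p * ((s + t) / 2) + r * ((s' + t') / 2))\<bar> \<le> q"
proof -
  let ?H = "\<lambda>u. (LINT v:{s'..t'}|lebesgue. g (u, v)) / (t' - s')"
  let ?B = "\<lambda>u. (LINT v:{s'..t'}|lborel. G (u, v)) / (t' - s')"
  have H0: "?B \<in> borel_measurable borel"
    unfolding set_lebesgue_integral_def by measurable
  have "AE z in lborel \<Otimes>\<^sub>M lborel. z \<in> {s..t} \<times> {s'..t'} \<longrightarrow> g z = G z"
    using ae by (simp only: lborel_prod)
  from lborel_pair.AE_pair[OF this]
  have sec: "AE u in lborel. u \<in> {s..t} \<longrightarrow>
      set_borel_measurable lebesgue {s'..t'} (\<lambda>v. g (u, v)) \<and> ?H u = ?B u"
  proof eventually_elim
    case (elim u)
    show ?case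
    proof
      assume u: "u \<in> {s..t}"
      have G: "(\<lambda>v. G (u, v)) \<in> borel_measurable borel" by measurable
      have "AE v in lborel. v \<in> {s'..t'} \<longrightarrow> g (u, v) = G (u, v)"
        using elim u by (elim eventually_mono) auto
      from interval_Borel_representative[OF G this]
      show "set_borel_measurable lebesgue {s'..t'} (\<lambda>v. g (u, v)) \<and> ?H u = ?B u" by simp
    qed
  qed
  have meas: "set_borel_measurable lebesgue {s..t} ?H"
    by (rule interval_Borel_representative(1)[OF H0]) (use sec in \<open>eventually_elim; blast\<close>)
  have "AE u in lborel. u \<in> {s..t} \<longrightarrow> \<bar>?H u - ((c + r * ((s' + t') / 2)) + p * u)\<bar> \<le> q"
    using sec
  proof eventually_elim
    case (elim u)
    show ?case
    proof
      assume u: "u \<in> {s..t}"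
      have "AE v in lebesgue. v \<in> {s'..t'} \<longrightarrow> \<bar>g (u, v) - ((c + p * u) + r * v)\<bar> \<le> q"
        using approx u by auto
      from interval_mean_affine_approx[OF \<open>s' < t'\<close> _ this] elim u
      show "\<bar>?H u - ((c + r * ((s' + t') / 2)) + p * u)\<bar> \<le> q" by (simp add: algebra_simps)
    qed
  qed
  from interval_mean_affine_approx[OF \<open>s < t\<close> meas AE_completion[OF this]]
  show ?thesis by (simp add: algebra_simps)
qed

text \<open>
  Composition with a map need not preserve Lebesgue measurability. The exponential change of
  coordinates does, because it has an invertible derivative everywhere, so that preimages of null
  sets are null: a Borel representative of \<open>f\<close> composed with it is one for the composition.
\<close>

lemma exp_pullback_Borel_representative:
  assumes "locally_integrable f"
  obtains G :: "real \<times> real \<Rightarrow> real" where "G \<in> borel_measurable borel"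
    "AE z in lborel. z \<in> {s..t} \<times> {s'..t'} \<longrightarrow> f (exp (fst z), exp (snd z)) = G z"
proof -
  let ?K = "{exp s..exp t} \<times> {exp s'..exp t'}"
  let ?E = "\<lambda>z::real \<times> real. (exp (fst z), exp (snd z))"
  have "compact ?K" by (intro compact_Times) auto
  moreover have "?K \<subseteq> R2pos" by (auto simp: R2pos_def intro: less_le_trans[OF exp_gt_zero])
  ultimately have "set_integrable lebesgue ?K f"
    using assms by (auto simp: locally_integrable_def)
  then have "(\<lambda>p. indicator ?K p *\<^sub>R f p) \<in> borel_measurable lebesgue"
    by (simp add: set_integrable_def)
  then obtain F where F[measurable]: "F \<in> borel_measurable borel"
    and AF: "AE p in lborel. indicator ?K p *\<^sub>R f p = F p"
    using completion_ex_borel_measurable_real[of _ lborel] by auto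
  let ?T = "{p. indicator ?K p *\<^sub>R f p \<noteq> F p}"
  have "negligible ?T"
    using AE_completion[OF AF] by (simp add: negligible_iff_null_sets AE_iff_null_sets completion.AE_iff_null_sets)
  then have "negligible {z \<in> UNIV. ?E z \<in> ?T}"
  proof (rule negligible_differentiable_vimage)
    fix z :: "real \<times> real"
    show "(?E has_derivative (\<lambda>h. (exp (fst z) * fst h, exp (snd z) * snd h))) (at z within UNIV)"
      by (auto intro!: derivative_eq_intros)
    show "inj (\<lambda>h::real \<times> real. (exp (fst z) * fst h, exp (snd z) * snd h))"
      by (auto simp: inj_def)
  qed
  then have "AE z in lebesgue. z \<notin> {z. ?E z \<in> ?T}"
    by (intro AE_not_in) (simp add: negligible_iff_null_sets)
  then have "AE z in lborel. z \<in> {s..t} \<times> {s'..t'} \<longrightarrow> f (?E z) = F (?E z)"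
    unfolding AE_completion_iff by eventually_elim (auto simp: indicator_def split: if_splits)
  moreover have "(\<lambda>z. F (?E z)) \<in> borel_measurable borel"
    by (rule measurable_compose[OF borel_measurable_continuous_onI F]) (intro continuous_intros)
  ultimately show thesis using that by blast
qed



section \<open>Second-order Taylor estimate in logarithmic coordinates\<close>

lemma eventually_nhds_box:
  fixes x y :: real
  assumes "eventually P (nhds (x, y))"
  obtains d where "d > 0" "\<And>s t. \<bar>s - x\<bar> < d \<Longrightarrow> \<bar>t - y\<bar> < d \<Longrightarrow> P (s, t)"
proof -
  obtain e where "e > 0" and e: "\<And>p. dist p (x, y) < e \<Longrightarrow> P p"
    using assms by (auto simp: eventually_nhds_metric)
  show thesis
  proof (rule that[of "e / 2"])
    fix s t assume "\<bar>s - x\<bar> < e / 2" "\<bar>t - y\<bar> < e / 2"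
    moreover have "dist (s, t) (x, y) \<le> \<bar>s - x\<bar> + \<bar>t - y\<bar>"
      by (simp add: dist_Pair_Pair dist_real_def sqrt_sum_squares_le_sum_abs)
    ultimately show "P (s, t)" by (intro e) linarith
  qed (use \<open>e > 0\<close> in simp)
qed

text \<open>
  Both partial derivatives are bounded near the point by continuity, and the increment splits into
  a horizontal and a vertical one, to which the mean value inequality applies.
\<close>

lemma C1_pointwise_Lipschitz:
  assumes "open U" "(x, y) \<in> U" and h: "Cn_on 1 U h"
  obtains d C where "d > 0" "C \<ge> 0"
    "\<And>s t. \<bar>s - x\<bar> < d \<Longrightarrow> \<bar>t - y\<bar> < d \<Longrightarrow>
       (s, t) \<in> U \<and> \<bar>h (s, t) - h (x, y)\<bar> \<le> C * (\<bar>s - x\<bar> + \<bar>t - y\<bar>)"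
proof -
  have diff: "((\<lambda>s. h (s, t)) has_field_derivative partial_x h (s, t)) (at s)"
    "((\<lambda>t. h (s, t)) has_field_derivative partial_y h (s, t)) (at t)" if "(s, t) \<in> U" for s t
    using h that by (auto simp: partial_x_def partial_y_def field_differentiable_derivI)
  define B where "B = \<bar>partial_x h (x, y)\<bar> + \<bar>partial_y h (x, y)\<bar> + 1"
  have "isCont (partial_x h) (x, y)" "isCont (partial_y h) (x, y)"
    using h assms by (auto simp: continuous_on_eq_continuous_at)
  then have "((\<lambda>p. \<bar>partial_x h p\<bar>) \<longlongrightarrow> \<bar>partial_x h (x, y)\<bar>) (nhds (x, y))"
    "((\<lambda>p. \<bar>partial_y h p\<bar>) \<longlongrightarrow> \<bar>partial_y h (x, y)\<bar>) (nhds (x, y))"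
    by (auto intro!: tendsto_rabs simp: continuous_at tendsto_at_iff_tendsto_nhds)
  then have "\<forall>\<^sub>F p in nhds (x, y). \<bar>partial_x h p\<bar> < B" "\<forall>\<^sub>F p in nhds (x, y). \<bar>partial_y h p\<bar> < B"
    by (auto elim!: order_tendstoD(2) simp: B_def)
  moreover have "\<forall>\<^sub>F p in nhds (x, y). p \<in> U"
    using assms by (simp add: eventually_nhds_in_open)
  ultimately have "\<forall>\<^sub>F p in nhds (x, y). p \<in> U \<and> \<bar>partial_x h p\<bar> < B \<and> \<bar>partial_y h p\<bar> < B"
    by eventually_elim auto
  then obtain d where "d > 0" and d: "\<And>s t. \<bar>s - x\<bar> < d \<Longrightarrow> \<bar>t - y\<bar> < d \<Longrightarrow>
      (s, t) \<in> U \<and> \<bar>partial_x h (s, t)\<bar> < B \<and> \<bar>partial_y h (s, t)\<bar> < B"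
    by (rule eventually_nhds_box) blast
  show thesis
  proof (rule that[OF \<open>d > 0\<close>, of B])
    fix s t assume st: "\<bar>s - x\<bar> < d" "\<bar>t - y\<bar> < d"
    have "norm (h (s, t) - h (x, t)) \<le> B * norm (s - x)"
    proof (rule field_differentiable_bound[where S = "ball x d" and f' = "\<lambda>\<sigma>. partial_x h (\<sigma>, t)"])
      fix \<sigma> assume "\<sigma> \<in> ball x d"
      then have "\<bar>\<sigma> - x\<bar> < d" by (simp add: dist_real_def abs_minus_commute)
      with d[of \<sigma> t] st diff(1)[of \<sigma> t]
      show "((\<lambda>\<sigma>. h (\<sigma>, t)) has_field_derivative partial_x h (\<sigma>, t)) (at \<sigma> within ball x d)"
        "norm (partial_x h (\<sigma>, t)) \<le> B"
        by (auto intro: has_field_derivative_at_within)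
    qed (use st \<open>d > 0\<close> in \<open>auto simp: dist_real_def abs_minus_commute\<close>)
    moreover have "norm (h (x, t) - h (x, y)) \<le> B * norm (t - y)"
    proof (rule field_differentiable_bound[where S = "ball y d" and f' = "\<lambda>\<tau>. partial_y h (x, \<tau>)"])
      fix \<tau> assume "\<tau> \<in> ball y d"
      then have "\<bar>\<tau> - y\<bar> < d" by (simp add: dist_real_def abs_minus_commute)
      with d[of x \<tau>] \<open>d > 0\<close> diff(2)[of x \<tau>]
      show "((\<lambda>\<tau>. h (x, \<tau>)) has_field_derivative partial_y h (x, \<tau>)) (at \<tau> within ball y d)"
        "norm (partial_y h (x, \<tau>)) \<le> B"
        by (auto intro: has_field_derivative_at_within)
    qed (use st \<open>d > 0\<close> in \<open>auto simp: dist_real_def abs_minus_commute\<close>)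
    ultimately show "(s, t) \<in> U \<and> \<bar>h (s, t) - h (x, y)\<bar> \<le> B * (\<bar>s - x\<bar> + \<bar>t - y\<bar>)"
      using d st by (auto simp: algebra_simps)
  qed (simp add: B_def)
qed

text \<open>
  The increment is split into a horizontal and a vertical one. After subtraction
  of the linear term, each has as its derivative a difference of values of one first partial
  derivative, which is bounded linearly by the pointwise Lipschitz estimate.
\<close>

lemma C2_Taylor_remainder:
  assumes "locally_Cn_at 2 (x, y) f"
  obtains d C where "d > 0" "C \<ge> 0"
    "\<And>s t. \<bar>s - x\<bar> < d \<Longrightarrow> \<bar>t - y\<bar> < d \<Longrightarrow>
       \<bar>f (s, t) - (f (x, y) + partial_x f (x, y) * (s - x) + partial_y f (x, y) * (t - y))\<bar>
         \<le> C * (\<bar>s - x\<bar> + \<bar>t - y\<bar>)\<^sup>2"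
proof -
  obtain U where U: "open U" "(x, y) \<in> U" and f: "Cn_on (Suc 1) U f"
    using assms by (auto simp: locally_Cn_at_def numeral_2_eq_2)
  have diff: "((\<lambda>s. f (s, t)) has_field_derivative partial_x f (s, t)) (at s)"
    "((\<lambda>t. f (s, t)) has_field_derivative partial_y f (s, t)) (at t)" if "(s, t) \<in> U" for s t
    using f that by (auto simp: partial_x_def partial_y_def field_differentiable_derivI)
  have Cx: "Cn_on 1 U (partial_x f)" and Cy: "Cn_on 1 U (partial_y f)" using f by simp_all
  obtain d1 C1 where "d1 > 0" "C1 \<ge> 0"
    and 1: "\<And>s t. \<bar>s - x\<bar> < d1 \<Longrightarrow> \<bar>t - y\<bar> < d1 \<Longrightarrow>
       (s, t) \<in> U \<and> \<bar>partial_x f (s, t) - partial_x f (x, y)\<bar> \<le> C1 * (\<bar>s - x\<bar> + \<bar>t - y\<bar>)"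
    using C1_pointwise_Lipschitz[OF U Cx] by blast
  obtain d2 C2 where "d2 > 0" "C2 \<ge> 0"
    and 2: "\<And>s t. \<bar>s - x\<bar> < d2 \<Longrightarrow> \<bar>t - y\<bar> < d2 \<Longrightarrow>
       (s, t) \<in> U \<and> \<bar>partial_y f (s, t) - partial_y f (x, y)\<bar> \<le> C2 * (\<bar>s - x\<bar> + \<bar>t - y\<bar>)"
    using C1_pointwise_Lipschitz[OF U Cy] by blast
  show thesis
  proof (rule that[of "min d1 d2" "C1 + C2"])
    fix s t assume st: "\<bar>s - x\<bar> < min d1 d2" "\<bar>t - y\<bar> < min d1 d2"
    define r where "r = \<bar>s - x\<bar> + \<bar>t - y\<bar>"
    have "norm ((f (s, t) - partial_x f (x, y) * s) - (f (x, t) - partial_x f (x, y) * x))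
        \<le> (C1 * r) * norm (s - x)"
    proof (rule field_differentiable_bound[where S = "cball x \<bar>s - x\<bar>"
          and f' = "\<lambda>\<sigma>. partial_x f (\<sigma>, t) - partial_x f (x, y)"])
      fix \<sigma> assume "\<sigma> \<in> cball x \<bar>s - x\<bar>"
      then have \<sigma>: "\<bar>\<sigma> - x\<bar> \<le> \<bar>s - x\<bar>" by (simp add: dist_real_def abs_minus_commute)
      have *: "(\<sigma>, t) \<in> U" "\<bar>partial_x f (\<sigma>, t) - partial_x f (x, y)\<bar> \<le> C1 * (\<bar>\<sigma> - x\<bar> + \<bar>t - y\<bar>)"
        using 1[of \<sigma> t] st \<sigma> by auto
      show "((\<lambda>\<sigma>. f (\<sigma>, t) - partial_x f (x, y) * \<sigma>) has_field_derivative
          partial_x f (\<sigma>, t) - partial_x f (x, y)) (at \<sigma> within cball x \<bar>s - x\<bar>)"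
        by (auto intro!: derivative_eq_intros has_field_derivative_at_within[OF diff(1)] *)
      have "C1 * (\<bar>\<sigma> - x\<bar> + \<bar>t - y\<bar>) \<le> C1 * r"
        using \<sigma> \<open>C1 \<ge> 0\<close> by (intro mult_left_mono) (auto simp: r_def)
      with * show "norm (partial_x f (\<sigma>, t) - partial_x f (x, y)) \<le> C1 * r" by simp
    qed (auto simp: dist_real_def)
    moreover have "norm ((f (x, t) - partial_y f (x, y) * t) - (f (x, y) - partial_y f (x, y) * y))
        \<le> (C2 * r) * norm (t - y)"
    proof (rule field_differentiable_bound[where S = "cball y \<bar>t - y\<bar>"
          and f' = "\<lambda>\<tau>. partial_y f (x, \<tau>) - partial_y f (x, y)"])
      fix \<tau> assume "\<tau> \<in> cball y \<bar>t - y\<bar>"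
      then have \<tau>: "\<bar>\<tau> - y\<bar> \<le> \<bar>t - y\<bar>" by (simp add: dist_real_def abs_minus_commute)
      have *: "(x, \<tau>) \<in> U" "\<bar>partial_y f (x, \<tau>) - partial_y f (x, y)\<bar> \<le> C2 * \<bar>\<tau> - y\<bar>"
        using 2[of x \<tau>] st \<tau> \<open>d2 > 0\<close> by auto
      show "((\<lambda>\<tau>. f (x, \<tau>) - partial_y f (x, y) * \<tau>) has_field_derivative
          partial_y f (x, \<tau>) - partial_y f (x, y)) (at \<tau> within cball y \<bar>t - y\<bar>)"
        by (auto intro!: derivative_eq_intros has_field_derivative_at_within[OF diff(2)] *)
      have "C2 * \<bar>\<tau> - y\<bar> \<le> C2 * r"
        using \<tau> \<open>C2 \<ge> 0\<close> by (intro mult_left_mono) (auto simp: r_def)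
      with * show "norm (partial_y f (x, \<tau>) - partial_y f (x, y)) \<le> C2 * r" by simp
    qed (auto simp: dist_real_def)
    moreover have "(C1 * r) * \<bar>s - x\<bar> \<le> (C1 * r) * r" "(C2 * r) * \<bar>t - y\<bar> \<le> (C2 * r) * r"
      using \<open>C1 \<ge> 0\<close> \<open>C2 \<ge> 0\<close> by (auto intro!: mult_left_mono simp: r_def)
    moreover have "(C1 + C2) * r\<^sup>2 = (C1 * r) * r + (C2 * r) * r"
      by (simp add: power2_eq_square algebra_simps)
    moreover have "f (s, t) - (f (x, y) + partial_x f (x, y) * (s - x) + partial_y f (x, y) * (t - y))
        = ((f (s, t) - partial_x f (x, y) * s) - (f (x, t) - partial_x f (x, y) * x))
        + ((f (x, t) - partial_y f (x, y) * t) - (f (x, y) - partial_y f (x, y) * y))"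
      by (simp add: algebra_simps)
    ultimately show "\<bar>f (s, t) - (f (x, y) + partial_x f (x, y) * (s - x)
        + partial_y f (x, y) * (t - y))\<bar> \<le> (C1 + C2) * (\<bar>s - x\<bar> + \<bar>t - y\<bar>)\<^sup>2"
      unfolding r_def[symmetric] real_norm_def by linarith
  qed (use \<open>d1 > 0\<close> \<open>d2 > 0\<close> \<open>C1 \<ge> 0\<close> \<open>C2 \<ge> 0\<close> in auto)
qed

lemma exp_minus_affine_le_square:
  fixes h :: real
  assumes "\<bar>h\<bar> \<le> 1"
  shows "\<bar>exp h - 1 - h\<bar> \<le> h\<^sup>2"
proof -
  have "exp h \<le> 1 + h + h\<^sup>2"
  proof (cases "h \<ge> 0")
    case True
    then show ?thesis using exp_bound[of h] assms by simp
  next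
    case False
    have "exp h = 1 / exp (- h)" by (simp add: exp_minus field_simps)
    also have "\<dots> \<le> 1 / (1 - h)"
      using exp_ge_add_one_self[of "- h"] False by (intro divide_left_mono) auto
    also have "\<dots> \<le> 1 + h + h\<^sup>2"
    proof -
      have "h ^ 3 \<le> 0" using False by (simp add: power_le_zero_eq)
      then have "1 \<le> (1 + h + h\<^sup>2) * (1 - h)"
        by (simp add: algebra_simps power2_eq_square power3_eq_cube)
      then show ?thesis using False by (simp add: pos_divide_le_eq)
    qed
    finally show ?thesis .
  qed
  then show ?thesis using exp_ge_add_one_self[of h] zero_le_power2[of h] by linarith
qed

text \<open>
  Away from the point, constants and linear terms are dominated by the square of the distance, so
  boundedness of \<open>g\<close> turns a local quadratic estimate into a global one. Every term of the sampling
  series can then be estimated in the same way, whether its cell is near to or far from the point.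
\<close>

lemma local_quadratic_remainder_imp_global:
  fixes g :: "real \<times> real \<Rightarrow> real"
  assumes bdd: "\<And>u v. \<bar>g (u, v)\<bar> \<le> B" and "\<delta> > 0" "C \<ge> 0"
    and loc: "\<And>u v. \<bar>u - a\<bar> < \<delta> \<Longrightarrow> \<bar>v - b\<bar> < \<delta> \<Longrightarrow>
      \<bar>g (u, v) - (g (a, b) + p * (u - a) + r * (v - b))\<bar> \<le> C * ((u - a)\<^sup>2 + (v - b)\<^sup>2)"
  obtains D where "D \<ge> 0"
    "\<And>u v. \<bar>g (u, v) - (g (a, b) + p * (u - a) + r * (v - b))\<bar> \<le> D * ((u - a)\<^sup>2 + (v - b)\<^sup>2)"
proof
  define D where "D = C + 2 * B / \<delta>\<^sup>2 + \<bar>p\<bar> / \<delta> + \<bar>r\<bar> / \<delta>"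
  have "B \<ge> 0" using bdd[of 0 0] by linarith
  then show "D \<ge> 0" using assms by (simp add: D_def)
  fix u v
  define Q where "Q = (u - a)\<^sup>2 + (v - b)\<^sup>2"
  have "Q \<ge> 0" by (simp add: Q_def)
  show "\<bar>g (u, v) - (g (a, b) + p * (u - a) + r * (v - b))\<bar> \<le> D * ((u - a)\<^sup>2 + (v - b)\<^sup>2)"
  proof (cases "\<bar>u - a\<bar> < \<delta> \<and> \<bar>v - b\<bar> < \<delta>")
    case True
    have "C * Q \<le> D * Q"
      using \<open>B \<ge> 0\<close> \<open>\<delta> > 0\<close> \<open>Q \<ge> 0\<close> by (intro mult_right_mono) (auto simp: D_def)
    with loc[of u v] True show ?thesis by (simp add: Q_def)
  next
    case False
    \<comment> \<open>Here \<open>1 \<le> Q / \<delta>\<^sup>2\<close>, so constants are absorbed, and linear terms by the inequality of the means.\<close>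
    have "\<delta>\<^sup>2 \<le> (u - a)\<^sup>2 \<or> \<delta>\<^sup>2 \<le> (v - b)\<^sup>2"
      using False \<open>\<delta> > 0\<close> abs_le_square_iff[of \<delta> "u - a"] abs_le_square_iff[of \<delta> "v - b"] by auto
    then have Q: "\<delta>\<^sup>2 \<le> Q" unfolding Q_def by (smt (verit) zero_le_power2)
    have lin: "\<bar>z\<bar> \<le> Q / \<delta>" if "z\<^sup>2 \<le> Q" for z
    proof -
      have "2 * (\<bar>z\<bar> * \<delta>) \<le> z\<^sup>2 + \<delta>\<^sup>2" using sum_squares_bound[of "\<bar>z\<bar>" \<delta>] by simp
      then show ?thesis using that Q \<open>\<delta> > 0\<close> by (simp add: pos_le_divide_eq)
    qed
    have "\<bar>p\<bar> * \<bar>u - a\<bar> \<le> \<bar>p\<bar> * (Q / \<delta>)" "\<bar>r\<bar> * \<bar>v - b\<bar> \<le> \<bar>r\<bar> * (Q / \<delta>)"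
      by (intro mult_left_mono lin; simp add: Q_def)+
    moreover have "2 * B * 1 \<le> 2 * B * (Q / \<delta>\<^sup>2)"
      using Q \<open>\<delta> > 0\<close> \<open>B \<ge> 0\<close> by (intro mult_left_mono) auto
    moreover have "0 \<le> C * Q" using \<open>C \<ge> 0\<close> \<open>Q \<ge> 0\<close> by simp
    moreover have "\<bar>g (u, v) - (g (a, b) + p * (u - a) + r * (v - b))\<bar>
        \<le> 2 * B + \<bar>p\<bar> * \<bar>u - a\<bar> + \<bar>r\<bar> * \<bar>v - b\<bar>"
      using bdd[of u v] bdd[of a b] by (simp add: abs_mult[symmetric])
    moreover have "D * Q = C * Q + 2 * B * (Q / \<delta>\<^sup>2) + \<bar>p\<bar> * (Q / \<delta>) + \<bar>r\<bar> * (Q / \<delta>)"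
      by (simp add: D_def algebra_simps)
    ultimately show ?thesis unfolding Q_def[symmetric] by linarith
  qed
qed

text \<open>
  In the coordinates \<open>u = ln s\<close> and \<open>v = ln t\<close> the Mellin derivatives are the ordinary partial
  derivatives of \<open>f (exp u, exp v)\<close>, by the chain rule. Here the chain rule is carried out on the level
  of the remainder: \<open>exp u - x\<close> differs from \<open>x * (u - ln x)\<close> by a quadratic term.
\<close>

lemma log_coordinates_quadratic_remainder:
  assumes "(x, y) \<in> R2pos" "bounded (f ` R2pos)" "locally_Cn_at 2 (x, y) f"
  obtains D where "D \<ge> 0"
    "\<And>u v. \<bar>f (exp u, exp v) - (f (x, y) + mellin_x f (x, y) * (u - ln x)
        + mellin_y f (x, y) * (v - ln y))\<bar> \<le> D * ((u - ln x)\<^sup>2 + (v - ln y)\<^sup>2)"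
proof -
  have "x > 0" "y > 0" using assms by (auto simp: R2pos_def)
  obtain d C where "d > 0" "C \<ge> 0" and T: "\<And>s t. \<bar>s - x\<bar> < d \<Longrightarrow> \<bar>t - y\<bar> < d \<Longrightarrow>
       \<bar>f (s, t) - (f (x, y) + partial_x f (x, y) * (s - x) + partial_y f (x, y) * (t - y))\<bar>
         \<le> C * (\<bar>s - x\<bar> + \<bar>t - y\<bar>)\<^sup>2"
    using C2_Taylor_remainder[OF assms(3)] by blast
  obtain B where B: "\<And>p. p \<in> R2pos \<Longrightarrow> \<bar>f p\<bar> \<le> B"
    using assms(2) by (auto simp: bounded_iff)
  \<comment> \<open>The factor 2 comes from \<open>\<bar>exp h - 1\<bar> \<le> 2 * \<bar>h\<bar>\<close> for \<open>\<bar>h\<bar> \<le> 1\<close>: it keeps \<open>exp u\<close> and \<open>exp v\<close> within \<open>d\<close> of \<open>x\<close> and \<open>y\<close>.\<close>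
  define \<delta> where "\<delta> = min 1 (min (d / (2 * x)) (d / (2 * y)))"
  define C' where "C' = 8 * C * (x\<^sup>2 + y\<^sup>2) + \<bar>partial_x f (x, y)\<bar> * x + \<bar>partial_y f (x, y)\<bar> * y"
  have "\<delta> > 0" "C' \<ge> 0" using \<open>d > 0\<close> \<open>x > 0\<close> \<open>y > 0\<close> \<open>C \<ge> 0\<close> by (auto simp: \<delta>_def C'_def)
  have exp_dev: "\<bar>exp u - z\<bar> < d \<and> \<bar>exp u - z\<bar> \<le> 2 * z * \<bar>u - ln z\<bar> \<and>
      \<bar>exp u - z - z * (u - ln z)\<bar> \<le> z * (u - ln z)\<^sup>2"
    if "z > 0" "\<bar>u - ln z\<bar> < 1" "\<bar>u - ln z\<bar> < d / (2 * z)" for u z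
  proof -
    define h where "h = u - ln z"
    have e: "exp u - z = z * (exp h - 1)" "exp u - z - z * h = z * (exp h - 1 - h)"
      using that by (simp_all add: h_def exp_diff algebra_simps)
    have "\<bar>h\<bar> * \<bar>h\<bar> \<le> \<bar>h\<bar> * 1"
      using that by (intro mult_left_mono) (auto simp: h_def)
    then have h2: "h\<^sup>2 \<le> \<bar>h\<bar>" by (simp add: power2_eq_square)
    have q: "\<bar>exp h - 1 - h\<bar> \<le> h\<^sup>2"
      using that by (intro exp_minus_affine_le_square) (simp add: h_def)
    then have "\<bar>exp h - 1\<bar> \<le> 2 * \<bar>h\<bar>" using h2 by linarith
    then have "z * \<bar>exp h - 1\<bar> \<le> z * (2 * \<bar>h\<bar>)"
      using \<open>z > 0\<close> by (intro mult_left_mono) auto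
    then have "\<bar>exp u - z\<bar> \<le> 2 * z * \<bar>h\<bar>"
      using \<open>z > 0\<close> by (simp add: e abs_mult)
    moreover have "2 * z * \<bar>h\<bar> < d"
      using that by (simp add: h_def pos_less_divide_eq mult.commute)
    moreover have "\<bar>exp u - z - z * h\<bar> \<le> z * h\<^sup>2"
      using mult_left_mono[OF q, of z] \<open>z > 0\<close> unfolding e(2) by (simp add: abs_mult)
    ultimately show ?thesis by (simp add: h_def)
  qed
  have gab: "f (exp (ln x), exp (ln y)) = f (x, y)" using \<open>x > 0\<close> \<open>y > 0\<close> by simp
  have loc: "\<bar>f (exp u, exp v) - (f (x, y) + mellin_x f (x, y) * (u - ln x)
        + mellin_y f (x, y) * (v - ln y))\<bar> \<le> C' * ((u - ln x)\<^sup>2 + (v - ln y)\<^sup>2)"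
    if "\<bar>u - ln x\<bar> < \<delta>" "\<bar>v - ln y\<bar> < \<delta>" for u v
  proof -
    define h k where "h = u - ln x" and "k = v - ln y"
    have u: "\<bar>exp u - x\<bar> < d" "\<bar>exp u - x\<bar> \<le> 2 * x * \<bar>h\<bar>" "\<bar>exp u - x - x * h\<bar> \<le> x * h\<^sup>2"
      using exp_dev[OF \<open>x > 0\<close>, of u] that(1) by (auto simp: \<delta>_def h_def)
    have v: "\<bar>exp v - y\<bar> < d" "\<bar>exp v - y\<bar> \<le> 2 * y * \<bar>k\<bar>" "\<bar>exp v - y - y * k\<bar> \<le> y * k\<^sup>2"
      using exp_dev[OF \<open>y > 0\<close>, of v] that(2) by (auto simp: \<delta>_def k_def)
    have "(\<bar>exp u - x\<bar> + \<bar>exp v - y\<bar>)\<^sup>2 \<le> (2 * (x * \<bar>h\<bar> + y * \<bar>k\<bar>))\<^sup>2"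
      using u v by (intro power_mono) auto
    also have "\<dots> \<le> 8 * (x\<^sup>2 + y\<^sup>2) * (h\<^sup>2 + k\<^sup>2)"
    proof -
      have "2 * ((x * \<bar>h\<bar>) * (y * \<bar>k\<bar>)) \<le> (x * \<bar>h\<bar>)\<^sup>2 + (y * \<bar>k\<bar>)\<^sup>2"
        using sum_squares_bound[of "x * \<bar>h\<bar>" "y * \<bar>k\<bar>"] by (simp only: mult.assoc)
      then have "(x * \<bar>h\<bar> + y * \<bar>k\<bar>)\<^sup>2 \<le> 2 * (x\<^sup>2 * h\<^sup>2 + y\<^sup>2 * k\<^sup>2)"
        by (simp add: power2_sum power_mult_distrib algebra_simps)
      moreover have "0 \<le> x\<^sup>2 * k\<^sup>2" "0 \<le> y\<^sup>2 * h\<^sup>2" by simp_all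
      moreover have "8 * (x\<^sup>2 + y\<^sup>2) * (h\<^sup>2 + k\<^sup>2)
          = 4 * (2 * (x\<^sup>2 * h\<^sup>2 + y\<^sup>2 * k\<^sup>2)) + 8 * (x\<^sup>2 * k\<^sup>2) + 8 * (y\<^sup>2 * h\<^sup>2)"
        by (simp add: algebra_simps)
      moreover have "(2 * z)\<^sup>2 = 4 * z\<^sup>2" for z :: real by (simp add: power_mult_distrib)
      ultimately show ?thesis by (smt (verit))
    qed
    finally have "C * (\<bar>exp u - x\<bar> + \<bar>exp v - y\<bar>)\<^sup>2 \<le> C * (8 * (x\<^sup>2 + y\<^sup>2) * (h\<^sup>2 + k\<^sup>2))"
      using \<open>C \<ge> 0\<close> by (rule mult_left_mono)
    with T[of "exp u" "exp v"] u(1) v(1)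
    have 1: "\<bar>f (exp u, exp v) - (f (x, y) + partial_x f (x, y) * (exp u - x)
        + partial_y f (x, y) * (exp v - y))\<bar> \<le> C * (8 * (x\<^sup>2 + y\<^sup>2) * (h\<^sup>2 + k\<^sup>2))" by linarith
    have "\<bar>partial_x f (x, y) * (exp u - x - x * h)\<bar> \<le> \<bar>partial_x f (x, y)\<bar> * (x * (h\<^sup>2 + k\<^sup>2))"
      unfolding abs_mult using u(3) \<open>x > 0\<close>
      by (intro mult_left_mono) (auto simp: algebra_simps intro: order_trans)
    moreover have "\<bar>partial_y f (x, y) * (exp v - y - y * k)\<bar> \<le> \<bar>partial_y f (x, y)\<bar> * (y * (h\<^sup>2 + k\<^sup>2))"
      unfolding abs_mult using v(3) \<open>y > 0\<close>
      by (intro mult_left_mono) (auto simp: algebra_simps intro: order_trans)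
    moreover have "f (exp u, exp v) - (f (x, y) + mellin_x f (x, y) * h + mellin_y f (x, y) * k)
       = (f (exp u, exp v) - (f (x, y) + partial_x f (x, y) * (exp u - x)
          + partial_y f (x, y) * (exp v - y)))
         + partial_x f (x, y) * (exp u - x - x * h) + partial_y f (x, y) * (exp v - y - y * k)"
      by (simp add: mellin_x_def mellin_y_def algebra_simps)
    moreover have "C' * (h\<^sup>2 + k\<^sup>2) = C * (8 * (x\<^sup>2 + y\<^sup>2) * (h\<^sup>2 + k\<^sup>2))
        + \<bar>partial_x f (x, y)\<bar> * (x * (h\<^sup>2 + k\<^sup>2)) + \<bar>partial_y f (x, y)\<bar> * (y * (h\<^sup>2 + k\<^sup>2))"
      by (simp add: C'_def algebra_simps)
    ultimately show ?thesis using 1 unfolding h_def[symmetric] k_def[symmetric] by linarith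
  qed
  have bdd: "\<bar>f (exp u, exp v)\<bar> \<le> B" for u v by (rule B) (simp add: R2pos_def)
  show thesis
    by (rule local_quadratic_remainder_imp_global[where g = "\<lambda>(u, v). f (exp u, exp v)"
          and a = "ln x" and b = "ln y" and p = "mellin_x f (x, y)" and r = "mellin_y f (x, y)",
          OF _ \<open>\<delta> > 0\<close> \<open>C' \<ge> 0\<close>])
      (use loc bdd gab that in auto)
qed

section \<open>Absolute moments of the kernel\<close>

lemma kernel_second_moment_partial_sums:
  assumes "\<kappa> \<in> kernel_class" "p + q = 2"
  obtains M where "\<And>u v F. (u, v) \<in> R2pos \<Longrightarrow> finite F \<Longrightarrow> sum (abs_moment_term p q \<kappa> u v) F \<le> M"
proof (rule that[of "enn2real (abs_moment p q \<kappa>)"])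
  have "finite {abs_moment p q \<kappa> | p q. p + q = 2}"
    by (rule finite_subset[of _ "(\<lambda>(p, q). abs_moment p q \<kappa>) ` ({..2} \<times> {..2})"]) auto
  then have "abs_moment p q \<kappa> \<le> abs_moment_order 2 \<kappa>"
    unfolding abs_moment_order_def using assms(2) by (intro Max_ge) auto
  also have "\<dots> < \<infinity>" using assms(1) by (simp add: kernel_class_def)
  finally have fin: "abs_moment p q \<kappa> < \<infinity>" .
  fix u v and F :: "(int \<times> int) set" assume uv: "(u, v) \<in> R2pos" and F: "finite F"
  let ?t = "abs_moment_term p q \<kappa> u v"
  have nn: "?t kj \<ge> 0" for kj by (simp add: abs_moment_term_def case_prod_unfold)
  have "ennreal (sum ?t F) = (\<Sum>\<^sub>\<infinity>kj\<in>F. ennreal (?t kj))"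
    using F nn by (simp add: sum_ennreal)
  also have "\<dots> \<le> (\<Sum>\<^sub>\<infinity>kj. ennreal (?t kj))"
    by (intro infsum_mono_neutral) (auto intro!: nonneg_summable_on_complete)
  also have "\<dots> \<le> abs_moment p q \<kappa>"
    unfolding abs_moment_def using uv by (intro SUP_upper2[of "(u, v)"]) auto
  finally show "sum ?t F \<le> enn2real (abs_moment p q \<kappa>)"
    using fin nn by (metis enn2real_ennreal enn2real_mono sum_nonneg infinity_ennreal_def)
qed

text \<open>
  Only the absolute moments of order two are assumed finite; those of lower order follow. At lattice
  points at distance at least 1 from \<open>(ln u, ln v)\<close> the quadratic weight is at least 1. At most
  four lattice points remain, and there the boundedness of the kernel is used. The resulting bound does not
  depend on \<open>(u, v)\<close>, which is essential as \<open>(u, v)\<close> will be \<open>(x powr w, y powr w)\<close>.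
\<close>

lemma kernel_weighted_absolute_sum:
  assumes "\<kappa> \<in> kernel_class"
  obtains M where "\<And>u v. (u, v) \<in> R2pos \<Longrightarrow>
    (\<lambda>(k, j). \<bar>\<kappa> (exp (- of_int k) * u, exp (- of_int j) * v)\<bar>
       * (1 + (of_int k - ln u)\<^sup>2 + (of_int j - ln v)\<^sup>2)) summable_on (UNIV :: (int \<times> int) set) \<and>
    (\<Sum>\<^sub>\<infinity>(k, j) \<in> (UNIV :: (int \<times> int) set). \<bar>\<kappa> (exp (- of_int k) * u, exp (- of_int j) * v)\<bar>
       * (1 + (of_int k - ln u)\<^sup>2 + (of_int j - ln v)\<^sup>2)) \<le> M"
proof -
  have order: "2 + 0 = (2::nat)" "0 + 2 = (2::nat)" by simp_all
  obtain M1 where M1: "\<And>u v F. (u, v) \<in> R2pos \<Longrightarrow> finite F \<Longrightarrow> sum (abs_moment_term 2 0 \<kappa> u v) F \<le> M1"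
    using kernel_second_moment_partial_sums[OF assms order(1)] by blast
  obtain M2 where M2: "\<And>u v F. (u, v) \<in> R2pos \<Longrightarrow> finite F \<Longrightarrow> sum (abs_moment_term 0 2 \<kappa> u v) F \<le> M2"
    using kernel_second_moment_partial_sums[OF assms order(2)] by blast
  obtain B where B: "\<And>p. p \<in> R2pos \<Longrightarrow> \<bar>\<kappa> p\<bar> \<le> B"
    using assms by (auto simp: kernel_class_def bounded_iff)
  have "B \<ge> 0" using B[of "(1, 1)"] by (auto simp: R2pos_def)
  show thesis
  proof (rule that)
    fix u v :: real assume uv: "(u, v) \<in> R2pos"
    define c :: "int \<times> int \<Rightarrow> real" where
      "c = (\<lambda>(k, j). \<bar>\<kappa> (exp (- of_int k) * u, exp (- of_int j) * v)\<bar>)"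
    define S :: "int \<times> int \<Rightarrow> real" where
      "S = (\<lambda>(k, j). (of_int k - ln u)\<^sup>2 + (of_int j - ln v)\<^sup>2)"
    \<comment> \<open>An integer within distance less than 1 of a real \<open>\<alpha>\<close> is \<open>\<lfloor>\<alpha>\<rfloor>\<close> or \<open>\<lfloor>\<alpha>\<rfloor> + 1\<close>.\<close>
    define near :: "(int \<times> int) set" where
      "near = {\<lfloor>ln u\<rfloor>..\<lfloor>ln u\<rfloor> + 1} \<times> {\<lfloor>ln v\<rfloor>..\<lfloor>ln v\<rfloor> + 1}"
    have nn: "c z \<ge> 0" "S z \<ge> 0" for z by (auto simp: c_def S_def split: prod.split)
    have "finite near" "card near = 4" by (simp_all add: near_def card_cartesian_product)
    have cB: "c z \<le> B" for z
      using uv by (auto simp: c_def R2pos_def split: prod.split intro!: B)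
    have far: "S z \<ge> 1" if "z \<notin> near" for z
    proof -
      obtain k j where z: "z = (k, j)" by force
      have "1 \<le> \<bar>of_int k - ln u\<bar> \<or> 1 \<le> \<bar>of_int j - ln v\<bar>"
        using that unfolding z near_def by auto linarith+
      then have "1 \<le> (of_int k - ln u)\<^sup>2 \<or> 1 \<le> (of_int j - ln v)\<^sup>2"
        using abs_le_square_iff[of 1] by auto
      then show ?thesis by (auto simp: S_def z intro: add_increasing add_increasing2)
    qed
    have split: "c z * (1 + S z) \<le> 2 * (c z * S z) + (if z \<in> near then B else 0)" for z
    proof (cases "z \<in> near")
      case True
      then show ?thesis using cB[of z] mult_nonneg_nonneg[OF nn(1)[of z] nn(2)[of z]] by (simp add: algebra_simps)
    next
      case False
      then show ?thesis using mult_left_mono[OF far[of z] nn(1)[of z]] by (simp add: algebra_simps)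
    qed
    have bound: "(\<Sum>z\<in>F. c z * (1 + S z)) \<le> 2 * (M1 + M2) + 4 * B" if "finite F" for F
    proof -
      have "(\<Sum>z\<in>F. c z * (1 + S z)) \<le> (\<Sum>z\<in>F. 2 * (c z * S z) + (if z \<in> near then B else 0))"
        by (intro sum_mono split)
      also have "\<dots> = 2 * (sum (abs_moment_term 2 0 \<kappa> u v) F + sum (abs_moment_term 0 2 \<kappa> u v) F)
          + (\<Sum>z\<in>F \<inter> near. B)"
      proof -
        have "c z * S z = abs_moment_term 2 0 \<kappa> u v z + abs_moment_term 0 2 \<kappa> u v z" for z
          by (simp add: c_def S_def abs_moment_term_def algebra_simps split: prod.split)
        then show ?thesis
          using sum.inter_restrict[OF that, of "\<lambda>_. B" near]
          by (simp only: sum.distrib sum_distrib_left[symmetric])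
      qed
      also have "\<dots> \<le> 2 * (M1 + M2) + 4 * B"
      proof -
        have "(\<Sum>z\<in>F \<inter> near. B) \<le> (\<Sum>z\<in>near. B)"
          using \<open>finite near\<close> \<open>B \<ge> 0\<close> by (intro sum_mono2) auto
        then show ?thesis using M1[OF uv that] M2[OF uv that] \<open>card near = 4\<close> by simp
      qed
      finally show ?thesis .
    qed
    have summ: "(\<lambda>z. c z * (1 + S z)) summable_on UNIV"
      by (rule nonneg_bounded_partial_sums_imp_summable_on[where C = "2 * (M1 + M2) + 4 * B"])
        (use nn bound in \<open>auto intro!: eventually_finite_subsets_at_top_weakI\<close>)
    moreover have "(\<Sum>\<^sub>\<infinity>z. c z * (1 + S z)) \<le> 2 * (M1 + M2) + 4 * B"
      using summ bound by (intro infsum_le_finite_sums) auto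
    ultimately show "(\<lambda>(k, j). \<bar>\<kappa> (exp (- of_int k) * u, exp (- of_int j) * v)\<bar>
       * (1 + (of_int k - ln u)\<^sup>2 + (of_int j - ln v)\<^sup>2)) summable_on (UNIV :: (int \<times> int) set) \<and>
      (\<Sum>\<^sub>\<infinity>(k, j) \<in> (UNIV :: (int \<times> int) set). \<bar>\<kappa> (exp (- of_int k) * u, exp (- of_int j) * v)\<bar>
       * (1 + (of_int k - ln u)\<^sup>2 + (of_int j - ln v)\<^sup>2)) \<le> 2 * (M1 + M2) + 4 * B"
      by (simp add: c_def S_def case_prod_unfold add.assoc)
  qed
qed

section \<open>The asymptotic formula\<close>

text \<open>
  The mean of the affine part over a cell is its value at the centre
  \<open>((k + 1/2) / w, (j + 1/2) / w)\<close>. This offset by half a cell is the source of the factor 1/2 in the limit.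
\<close>

lemma cell_mean_quadratic_remainder:
  assumes "w > 0" "D \<ge> 0" "locally_integrable f"
    and rem: "\<And>u v. \<bar>f (exp u, exp v) - (c + p * (u - a) + r * (v - b))\<bar> \<le> D * ((u - a)\<^sup>2 + (v - b)\<^sup>2)"
  shows "\<bar>w\<^sup>2 * (LINT u:{of_int k / w..(of_int k + 1) / w}|lebesgue.
            (LINT v:{of_int j / w..(of_int j + 1) / w}|lebesgue. f (exp u, exp v)))
          - (c + (p * (of_int k - w * a + 1 / 2) + r * (of_int j - w * b + 1 / 2)) / w)\<bar>
        \<le> 4 * D / w\<^sup>2 * (1 + (of_int k - w * a)\<^sup>2 + (of_int j - w * b)\<^sup>2)"
proof -
  define s t s' t' where "s = of_int k / w" and "t = (of_int k + 1) / w"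
    and "s' = of_int j / w" and "t' = (of_int j + 1) / w"
  have lt: "s < t" "s' < t'" using \<open>w > 0\<close> by (auto simp: s_def t_def s'_def t'_def divide_strict_right_mono)
  have sq: "(z - e)\<^sup>2 \<le> 2 * ((of_int i - w * e)\<^sup>2 + 1) / w\<^sup>2"
    if "z \<in> {of_int i / w..(of_int i + 1) / w}" for z e and i :: int
  proof -
    have "0 \<le> w * z - of_int i" "w * z - of_int i \<le> 1"
      using that \<open>w > 0\<close> by (auto simp: field_simps)
    then have 1: "(w * z - of_int i)\<^sup>2 \<le> 1" by (simp add: power_le_one)
    have "(w * z - w * e)\<^sup>2 \<le> 2 * ((of_int i - w * e)\<^sup>2 + (w * z - of_int i)\<^sup>2)"
      using sum_squares_bound[of "w * z - of_int i" "of_int i - w * e"]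
        power2_sum[of "w * z - of_int i" "of_int i - w * e"] by simp
    also have "\<dots> \<le> 2 * ((of_int i - w * e)\<^sup>2 + 1)"
      using 1 by (intro mult_left_mono add_left_mono) auto
    finally have "(w * z - w * e)\<^sup>2 \<le> 2 * ((of_int i - w * e)\<^sup>2 + 1)" .
    moreover have "(w * z - w * e)\<^sup>2 = (z - e)\<^sup>2 * w\<^sup>2"
      by (simp add: power2_eq_square algebra_simps)
    ultimately show ?thesis
      using \<open>w > 0\<close> by (simp only: pos_le_divide_eq zero_less_power)
  qed
  let ?q = "4 * D / w\<^sup>2 * (1 + (of_int k - w * a)\<^sup>2 + (of_int j - w * b)\<^sup>2)"
  have approx: "\<bar>(case (u, v) of (u, v) \<Rightarrow> f (exp u, exp v)) - ((c - p * a - r * b) + p * u + r * v)\<bar> \<le> ?q"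
    if "u \<in> {s..t}" "v \<in> {s'..t'}" for u v
  proof -
    have "(u - a)\<^sup>2 + (v - b)\<^sup>2
        \<le> 2 * ((of_int k - w * a)\<^sup>2 + 1) / w\<^sup>2 + 2 * ((of_int j - w * b)\<^sup>2 + 1) / w\<^sup>2"
      using that unfolding s_def t_def s'_def t'_def by (intro add_mono sq)
    also have "\<dots> = (4 + 2 * (of_int k - w * a)\<^sup>2 + 2 * (of_int j - w * b)\<^sup>2) / w\<^sup>2"
      by (simp add: add_divide_distrib[symmetric])
    also have "\<dots> \<le> (4 * (1 + (of_int k - w * a)\<^sup>2 + (of_int j - w * b)\<^sup>2)) / w\<^sup>2"
      by (intro divide_right_mono) auto
    finally have "D * ((u - a)\<^sup>2 + (v - b)\<^sup>2)
        \<le> D * ((4 * (1 + (of_int k - w * a)\<^sup>2 + (of_int j - w * b)\<^sup>2)) / w\<^sup>2)"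
      using \<open>D \<ge> 0\<close> by (rule mult_left_mono)
    also have "\<dots> = ?q" by simp
    finally have "D * ((u - a)\<^sup>2 + (v - b)\<^sup>2) \<le> ?q" .
    with rem[of u v] show ?thesis by (simp add: algebra_simps)
  qed
  obtain G where "G \<in> borel_measurable borel"
    "AE z in lborel. z \<in> {s..t} \<times> {s'..t'} \<longrightarrow> (case z of (u, v) \<Rightarrow> f (exp u, exp v)) = G z"
    using exp_pullback_Borel_representative[OF assms(3), of s t s' t'] by (auto simp: case_prod_unfold)
  from rectangle_mean_affine_approx[OF lt this approx]
  have "\<bar>(LINT u:{s..t}|lebesgue. LINT v:{s'..t'}|lebesgue. f (exp u, exp v)) / ((t - s) * (t' - s'))
      - ((c - p * a - r * b) + p * ((s + t) / 2) + r * ((s' + t') / 2))\<bar> \<le> ?q"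
    by simp
  moreover have "(t - s) * (t' - s') = 1 / w\<^sup>2"
    by (simp add: s_def t_def s'_def t'_def diff_divide_distrib[symmetric] power2_eq_square)
  moreover have "(c - p * a - r * b) + p * ((s + t) / 2) + r * ((s' + t') / 2)
      = c + (p * (of_int k - w * a + 1 / 2) + r * (of_int j - w * b + 1 / 2)) / w"
    using \<open>w > 0\<close> by (simp add: s_def t_def s'_def t'_def field_simps)
  ultimately show ?thesis by (simp add: s_def t_def s'_def t'_def mult.commute)
qed

theorem theorem3p2:
  fixes \<kappa> f :: "real \<times> real \<Rightarrow> real" and x y :: real
  assumes "\<kappa> \<in> kernel_class"
    and "\<And>u v. (u, v) \<in> R2pos \<Longrightarrow> moment 1 0 \<kappa> u v = 0"
    and "\<And>u v. (u, v) \<in> R2pos \<Longrightarrow> moment 0 1 \<kappa> u v = 0"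
    and "(x, y) \<in> R2pos"
    and "bounded (f ` R2pos)"
    and "locally_integrable f"
    and "locally_Cn_at 2 (x, y) f"
  shows "((\<lambda>w. w * (kantorovich_series \<kappa> w f (x, y) - f (x, y)))
           \<longlongrightarrow> (1 / 2) * (mellin_x f (x, y) + mellin_y f (x, y))) at_top"
proof -
  have pos: "x > 0" "y > 0" using assms(4) by (auto simp: R2pos_def)
  define a b p r where "a = ln x" and "b = ln y"
    and "p = mellin_x f (x, y)" and "r = mellin_y f (x, y)"
  obtain D where "D \<ge> 0" and D: "\<And>u v. \<bar>f (exp u, exp v) - (f (x, y) + p * (u - a) + r * (v - b))\<bar>
      \<le> D * ((u - a)\<^sup>2 + (v - b)\<^sup>2)"
    using log_coordinates_quadratic_remainder[OF assms(4,5,7)] unfolding a_def b_def p_def r_def by blast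
  obtain M where M: "\<And>u v. (u, v) \<in> R2pos \<Longrightarrow>
    (\<lambda>(k, j). \<bar>\<kappa> (exp (- of_int k) * u, exp (- of_int j) * v)\<bar>
       * (1 + (of_int k - ln u)\<^sup>2 + (of_int j - ln v)\<^sup>2)) summable_on (UNIV :: (int \<times> int) set) \<and>
    (\<Sum>\<^sub>\<infinity>(k, j) \<in> (UNIV :: (int \<times> int) set). \<bar>\<kappa> (exp (- of_int k) * u, exp (- of_int j) * v)\<bar>
       * (1 + (of_int k - ln u)\<^sup>2 + (of_int j - ln v)\<^sup>2)) \<le> M"
    using kernel_weighted_absolute_sum[OF assms(1)] by blast
  have key: "\<bar>w * (kantorovich_series \<kappa> w f (x, y) - f (x, y)) - (1 / 2) * (p + r)\<bar> \<le> 4 * D * M / w"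
    if "w > 0" for w
  proof -
    define K :: "int \<times> int \<Rightarrow> real" where
      "K = (\<lambda>(k, j). \<kappa> (exp (- of_int k) * x powr w, exp (- of_int j) * y powr w))"
    define \<alpha> \<beta> :: "int \<times> int \<Rightarrow> real" where
      "\<alpha> = (\<lambda>(k, j). of_int k - w * a)" and "\<beta> = (\<lambda>(k, j). of_int j - w * b)"
    define A :: "int \<times> int \<Rightarrow> real" where
      "A = (\<lambda>(k, j). w\<^sup>2 * (LINT u:{of_int k / w..(of_int k + 1) / w}|lebesgue.
          (LINT v:{of_int j / w..(of_int j + 1) / w}|lebesgue. f (exp u, exp v))))"
    define L where "L z = f (x, y) + (p * (\<alpha> z + 1 / 2) + r * (\<beta> z + 1 / 2)) / w" for z
    have uv: "(x powr w, y powr w) \<in> R2pos" using pos by (simp add: R2pos_def)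
    have lns: "ln (x powr w) = w * a" "ln (y powr w) = w * b"
      using pos by (simp_all add: a_def b_def ln_powr)
    have W: "(\<lambda>z. \<bar>K z\<bar> * (1 + (\<alpha> z)\<^sup>2 + (\<beta> z)\<^sup>2)) summable_on UNIV"
      "(\<Sum>\<^sub>\<infinity>z. \<bar>K z\<bar> * (1 + (\<alpha> z)\<^sup>2 + (\<beta> z)\<^sup>2)) \<le> M"
      using M[OF uv] unfolding lns by (simp_all add: K_def \<alpha>_def \<beta>_def case_prod_unfold)
    \<comment> \<open>Summability has to be known before the moment hypotheses say anything, since a divergent
      unordered sum also has the value 0.\<close>
    have dom: "(\<lambda>z. K z * e z) summable_on UNIV"
      if "\<And>z. \<bar>e z\<bar> \<le> 1 + (\<alpha> z)\<^sup>2 + (\<beta> z)\<^sup>2" for e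
    proof (rule abs_summable_summable, rule Infinite_Sum.abs_summable_on_comparison_test'[OF W(1)])
      show "norm (K z * e z) \<le> \<bar>K z\<bar> * (1 + (\<alpha> z)\<^sup>2 + (\<beta> z)\<^sup>2)" for z
        using that by (simp add: abs_mult mult_left_mono)
    qed
    have abs_le: "\<bar>z\<bar> \<le> 1 + z\<^sup>2 + z'\<^sup>2" "\<bar>z\<bar> \<le> 1 + z'\<^sup>2 + z\<^sup>2" for z z' :: real
    proof -
      have "2 * \<bar>z\<bar> \<le> z\<^sup>2 + 1" using sum_squares_bound[of "\<bar>z\<bar>" 1] by simp
      then show "\<bar>z\<bar> \<le> 1 + z\<^sup>2 + z'\<^sup>2" "\<bar>z\<bar> \<le> 1 + z'\<^sup>2 + z\<^sup>2"
        using zero_le_power2[of z'] abs_ge_zero[of z] by linarith+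
    qed
    have sum1: "(K has_sum 1) UNIV"
      using assms(1) uv by (auto simp: kernel_class_def K_def)
    have "(\<lambda>z. K z * \<alpha> z) summable_on UNIV"
      by (rule dom) (rule abs_le(1))
    then have sum\<alpha>: "((\<lambda>z. K z * \<alpha> z) has_sum 0) UNIV"
      using assms(2)[OF uv] unfolding moment_def lns
      by (simp add: K_def \<alpha>_def case_prod_unfold summable_iff_has_sum_infsum)
    have "(\<lambda>z. K z * \<beta> z) summable_on UNIV"
      by (rule dom) (rule abs_le(2))
    then have sum\<beta>: "((\<lambda>z. K z * \<beta> z) has_sum 0) UNIV"
      using assms(3)[OF uv] unfolding moment_def lns
      by (simp add: K_def \<beta>_def case_prod_unfold summable_iff_has_sum_infsum)
    \<comment> \<open>The normalisation of the kernel and its vanishing first moments evaluate the affine part exactly.\<close>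
    have "((\<lambda>z. (f (x, y) + (p + r) / (2 * w)) * K z + p / w * (K z * \<alpha> z) + r / w * (K z * \<beta> z))
        has_sum ((f (x, y) + (p + r) / (2 * w)) * 1 + p / w * 0 + r / w * 0)) UNIV"
      by (intro has_sum_add has_sum_cmult_right sum1 sum\<alpha> sum\<beta>)
    moreover have "(f (x, y) + (p + r) / (2 * w)) * K z + p / w * (K z * \<alpha> z) + r / w * (K z * \<beta> z)
        = K z * L z" for z
      using \<open>w > 0\<close> by (simp add: L_def field_simps)
    ultimately have sumL: "((\<lambda>z. K z * L z) has_sum (f (x, y) + (p + r) / (2 * w))) UNIV" by simp
    have AL: "\<bar>A z - L z\<bar> \<le> 4 * D / w\<^sup>2 * (1 + (\<alpha> z)\<^sup>2 + (\<beta> z)\<^sup>2)" for z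
      using cell_mean_quadratic_remainder[OF \<open>w > 0\<close> \<open>D \<ge> 0\<close> assms(6) D, of "fst z" "snd z"]
      by (simp add: A_def L_def \<alpha>_def \<beta>_def case_prod_unfold)
    let ?E = "\<lambda>z. 4 * D / w\<^sup>2 * (\<bar>K z\<bar> * (1 + (\<alpha> z)\<^sup>2 + (\<beta> z)\<^sup>2))"
    have E: "(?E has_sum (4 * D / w\<^sup>2 * (\<Sum>\<^sub>\<infinity>z. \<bar>K z\<bar> * (1 + (\<alpha> z)\<^sup>2 + (\<beta> z)\<^sup>2)))) UNIV"
      by (intro has_sum_cmult_right has_sum_infsum W)
    have err: "norm (K z * (A z - L z)) \<le> ?E z" for z
      using mult_left_mono[OF AL[of z] abs_ge_zero[of "K z"]] by (simp add: abs_mult mult.left_commute)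
    have "(\<lambda>z. K z * (A z - L z)) summable_on UNIV"
      by (rule abs_summable_summable, rule Infinite_Sum.abs_summable_on_comparison_test'[OF has_sum_imp_summable[OF E] err])
    then have R: "((\<lambda>z. K z * (A z - L z)) has_sum (\<Sum>\<^sub>\<infinity>z. K z * (A z - L z))) UNIV" by simp
    define \<epsilon> where "\<epsilon> = (\<Sum>\<^sub>\<infinity>z. K z * (A z - L z))"
    have "norm \<epsilon> \<le> 4 * D / w\<^sup>2 * (\<Sum>\<^sub>\<infinity>z. \<bar>K z\<bar> * (1 + (\<alpha> z)\<^sup>2 + (\<beta> z)\<^sup>2))"
      unfolding \<epsilon>_def by (rule norm_infsum_le[OF R E err])
    also have "\<dots> \<le> 4 * D / w\<^sup>2 * M"
      using \<open>D \<ge> 0\<close> by (intro mult_left_mono W) auto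
    finally have \<epsilon>: "\<bar>\<epsilon>\<bar> \<le> 4 * D / w\<^sup>2 * M" by simp
    have "((\<lambda>z. K z * A z) has_sum (f (x, y) + (p + r) / (2 * w) + \<epsilon>)) UNIV"
      using has_sum_add[OF sumL R] by (simp add: \<epsilon>_def algebra_simps)
    then have "kantorovich_series \<kappa> w f (x, y) = f (x, y) + (p + r) / (2 * w) + \<epsilon>"
      by (simp add: kantorovich_series_def K_def A_def case_prod_unfold mult.assoc infsumI)
    then have "w * (kantorovich_series \<kappa> w f (x, y) - f (x, y)) - (1 / 2) * (p + r) = w * \<epsilon>"
      using \<open>w > 0\<close> by (simp add: field_simps)
    moreover have "\<bar>w * \<epsilon>\<bar> \<le> w * (4 * D / w\<^sup>2 * M)"
      using mult_left_mono[OF \<epsilon>, of w] \<open>w > 0\<close> by (simp add: abs_mult)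
    moreover have "w * (4 * D / w\<^sup>2 * M) = 4 * D * M / w"
      using \<open>w > 0\<close> by (simp add: power2_eq_square)
    ultimately show ?thesis by simp
  qed
  have "((\<lambda>w. 4 * D * M / w) \<longlongrightarrow> 0) at_top"
    by (intro tendsto_divide_0[OF tendsto_const] filterlim_at_top_imp_at_infinity filterlim_ident)
  then have "((\<lambda>w. w * (kantorovich_series \<kappa> w f (x, y) - f (x, y)) - (1 / 2) * (p + r)) \<longlongrightarrow> 0) at_top"
    by (rule Lim_null_comparison[rotated])
      (use key in \<open>auto intro!: eventually_mono[OF eventually_gt_at_top[of 0]]\<close>)
  then show ?thesis unfolding p_def r_def by (rule LIM_zero_cancel)
qed

end
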